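(* If $G$ is a connected graph with $n(G)\ge 2$, then $\chi_{\rho}(M(G))\ge \chi_{\rho}(G) + 2$, with equality if $G$ is complete.
   Context: All graphs are finite and simple; $n(G)$ is the number of vertices of $G$. For a positive integer $i$, an $i$-packing in $G$ is a set $W\subseteq V(G)$ such that any two distinct vertices of $W$ are at distance greater than $i$ in $G$. The packing chromatic number $\chi_{\rho}(G)$ is the smallest integer $k$ such that $V(G)$ can be partitioned into sets $V_1,\dots,V_k$ with $V_i$ an $i$-packing for each $i\in\{1,\dots,k\}$. The Mycielskian $M(G)$ of $G$ is the graph with vertex set $V(G)\cup V'\cup\{w\}$, where $V'=\{x' : x\in V(G)\}$ is a set of new vertices and $w$ is a further new vertex, and edge set $E(G)\cup\{xy' : xy\in E(G)\}\cup\{wx' : x'\in V'\}$. *)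

theory Defs
  imports
    "Graph_Theory.Graph_Theory"
    "HOL-Library.Disjoint_Sets"
begin

text \<open>
  Finite simple graphs are symmetric, loop-free, finite pair digraphs (locale \<open>pair_graph\<close>):
  an undirected edge \<open>uv\<close> is the pair of arcs \<open>(u, v)\<close> and \<open>(v, u)\<close>.
\<close>

text \<open>Distance is the shortest-path cost with unit weights; it is \<open>\<infinity>\<close> between different components.\<close>

definition graph_dist :: "'a pair_pre_digraph \<Rightarrow> 'a \<Rightarrow> 'a \<Rightarrow> ereal" where
  "graph_dist G u v = wf_digraph.\<mu> (with_proj G) (\<lambda>_. 1) u v"

definition packing :: "'a pair_pre_digraph \<Rightarrow> nat \<Rightarrow> 'a set \<Rightarrow> bool" where
  "packing G i W \<longleftrightarrow>
     W \<subseteq> pverts G \<and> (\<forall>u\<in>W. \<forall>v\<in>W. u \<noteq> v \<longrightarrow> ereal (real i) < graph_dist G u v)"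

text \<open>
  Classes are indexed from 1 and may be empty. This does not affect the minimal \<open>k\<close>,
  since an empty \<open>V i\<close> could be replaced by \<open>V k\<close>.
\<close>

definition packing_colorable :: "'a pair_pre_digraph \<Rightarrow> nat \<Rightarrow> bool" where
  "packing_colorable G k \<longleftrightarrow>
     (\<exists>V :: nat \<Rightarrow> 'a set. disjoint_family_on V {1..k} \<and> (\<Union>i\<in>{1..k}. V i) = pverts G \<and>
        (\<forall>i\<in>{1..k}. packing G i (V i)))"

definition packing_chromatic_number :: "'a pair_pre_digraph \<Rightarrow> nat" where
  "packing_chromatic_number G = (LEAST k. packing_colorable G k)"

datatype 'a myc_vertex = Orig 'a | Copy 'a | Apex

definition mycielskian :: "'a pair_pre_digraph \<Rightarrow> 'a myc_vertex pair_pre_digraph" where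
  "mycielskian G = \<lparr>
     pverts = Orig ` pverts G \<union> Copy ` pverts G \<union> {Apex},
     parcs = {(Orig x, Orig y) | x y. (x, y) \<in> parcs G}
       \<union> {(Orig x, Copy y) | x y. (x, y) \<in> parcs G}
       \<union> {(Copy y, Orig x) | x y. (x, y) \<in> parcs G}
       \<union> {(Apex, Copy x) | x. x \<in> pverts G}
       \<union> {(Copy x, Apex) | x. x \<in> pverts G} \<rparr>"

lemma pair_graph_mycielskian:
  assumes "pair_graph G"
  shows "pair_graph (mycielskian G)"
proof -
  interpret pair_graph G by fact
  let ?M = "mycielskian G"
  have V: "finite (pverts ?M)"
    using pair_finite_verts by (simp add: mycielskian_def)
  have sub: "parcs ?M \<subseteq> pverts ?M \<times> pverts ?M"
    by (auto simp: mycielskian_def dest: in_arcsD1 in_arcsD2)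
  have fin: "finite (parcs ?M)"
    using finite_subset[OF sub] V by simp
  have sG: "(y, x) \<in> parcs G" if "(x, y) \<in> parcs G" for x y
    using pair_sym_arcs that by (auto simp: symmetric_def dest: symD)
  have sM: "symmetric ?M"
    by (auto simp: symmetric_def sym_def mycielskian_def intro: sG)
  have loop: "fst e \<noteq> snd e" if "e \<in> parcs ?M" for e
    using that pair_no_loops by (fastforce simp: mycielskian_def)
  show ?thesis
    using V sub fin sM loop by unfold_locales auto
qed

text \<open>The set minimised in \<open>packing_chromatic_number\<close> is nonempty for finite graphs.\<close>

lemma packing_colorable_card:
  assumes "finite (pverts G)"
  shows "packing_colorable G (card (pverts G))"
proof -
  obtain f where f: "bij_betw f {1..card (pverts G)} (pverts G)"
    using ex_bij_betw_nat_finite_1[OF assms] by blast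
  have "disjoint_family_on (\<lambda>i. {f i}) {1..card (pverts G)}"
    using f by (auto simp: disjoint_family_on_def bij_betw_def dest: inj_onD)
  moreover have "(\<Union>i\<in>{1..card (pverts G)}. {f i}) = pverts G"
    using f by (auto simp: bij_betw_def)
  moreover have "\<forall>i\<in>{1..card (pverts G)}. packing G i {f i}"
    using f by (auto simp: packing_def bij_betw_def)
  ultimately show ?thesis
    unfolding packing_colorable_def by (intro exI[of _ "\<lambda>i. {f i}"]) blast
qed

end

theory Submission
  imports Defs
begin

text \<open>
  Distances between original vertices do not increase in the Mycielskian, so a packing coloring
  of \<open>M(G)\<close> with \<open>k\<close> colors restricts to one of \<open>G\<close>. It remains to make two of the \<open>k\<close> colors
  disappear from \<open>G\<close>, after which the larger colors can be shifted down. Every original vertex is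
  at distance at most 2 from \<open>w\<close> and at most 3 from every copy, so any color \<open>\<ge> 2\<close> of \<open>w\<close> and any
  color \<open>\<ge> 3\<close> of a copy is absent from \<open>G\<close>. If \<open>w\<close> has color 1, the copies have pairwise distinct
  colors \<open>\<ge> 2\<close>, which gives two such colors if \<open>n(G) \<ge> 3\<close>; if \<open>n(G) = 2\<close>, every
  original is at distance at most 2 from every copy, so color 2 of a copy is absent as well. If \<open>w\<close> has a color \<open>\<ge> 2\<close> and all copies have color
  1 or 2, then colors 1 and 2 can be merged on \<open>G\<close>.
\<close>

lemma pair_wf_digraph_if_pair_graph: "pair_graph G \<Longrightarrow> pair_wf_digraph G"
  by (simp add: pair_graph_def pair_digraph_def pair_fin_digraph_def)

section \<open>Distances\<close>

text \<open>Under unit weights the cost of a walk is its length. An upper bound on a distance then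
  needs a single walk, a lower bound needs an estimate for every walk.\<close>

lemma graph_dist_conv_length:
  assumes "pair_wf_digraph G"
  shows "graph_dist G u v = (INF p\<in>{p. pre_digraph.awalk (with_proj G) u p v}. ereal (real (length p)))"
proof -
  interpret pair_wf_digraph G by fact
  have "awalk_cost (\<lambda>_. 1) p = real (length p)" for p :: "('a \<times> 'a) list"
    by (induction p) simp_all
  then show ?thesis
    by (simp add: graph_dist_def \<mu>_def)
qed

lemma graph_dist_le_length:
  assumes "pair_wf_digraph G" "pre_digraph.awalk (with_proj G) u p v"
  shows "graph_dist G u v \<le> ereal (real (length p))"
  unfolding graph_dist_conv_length[OF assms(1)] using assms(2) by (auto intro: INF_lower)

lemma graph_dist_le1:
  assumes "pair_wf_digraph G" "(u, v) \<in> parcs G"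
  shows "graph_dist G u v \<le> 1"
proof -
  interpret pair_wf_digraph G by fact
  have "awalk u [(u, v)] v"
    using assms(2) by (auto simp: awalk_def dest: in_arcsD1)
  from graph_dist_le_length[OF assms(1) this] show ?thesis by (simp add: one_ereal_def)
qed

lemma graph_dist_le2:
  assumes "pair_wf_digraph G" "(u, x) \<in> parcs G" "(x, v) \<in> parcs G"
  shows "graph_dist G u v \<le> 2"
proof -
  interpret pair_wf_digraph G by fact
  have "awalk u [(u, x), (x, v)] v"
    using assms(2,3) by (auto simp: awalk_def dest: in_arcsD1)
  from graph_dist_le_length[OF assms(1) this] show ?thesis by simp
qed

lemma graph_dist_le3:
  assumes "pair_wf_digraph G" "(u, x) \<in> parcs G" "(x, y) \<in> parcs G" "(y, v) \<in> parcs G"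
  shows "graph_dist G u v \<le> 3"
proof -
  interpret pair_wf_digraph G by fact
  have "awalk u [(u, x), (x, y), (y, v)] v"
    using assms(2-) by (auto simp: awalk_def dest: in_arcsD1)
  from graph_dist_le_length[OF assms(1) this] show ?thesis by simp
qed

lemma graph_dist_gt1:
  assumes "pair_wf_digraph G" "u \<noteq> v" "(u, v) \<notin> parcs G"
  shows "1 < graph_dist G u v"
proof -
  interpret pair_wf_digraph G by fact
  have "2 \<le> length p" if "awalk u p v" for p
  proof (cases p)
    case Nil
    with that assms(2) show ?thesis by (simp add: awalk_def)
  next
    case (Cons e es)
    with that assms(3) show ?thesis by (cases es) (auto simp: awalk_def)
  qed
  \<comment> \<open>Passing to the infimum keeps only weak bounds, hence 2 rather than a strict
    bound by 1. With no walk at all the infimum is infinite.\<close>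
  then have "2 \<le> graph_dist G u v"
    unfolding graph_dist_conv_length[OF assms(1)] by (intro INF_greatest) auto
  then show ?thesis
    by (rule less_le_trans[rotated]) (simp add: one_ereal_def)
qed

text \<open>A walk from \<open>x\<close> to a different vertex is nonempty, and its first arc leads
  to a neighbor. Symmetry of the arcs turns \<open>connected\<close> into directed
  reachability.\<close>

lemma connected_obtain_neighbor:
  assumes "pair_graph G" "connected (with_proj G)" "card (pverts G) \<ge> 2" "x \<in> pverts G"
  obtains y where "(x, y) \<in> parcs G"
proof -
  interpret pair_graph G by fact
  have "pverts G \<noteq> {x}" using assms(3) by auto
  then obtain z where z: "z \<in> pverts G" "z \<noteq> x" using assms(4) by auto
  have "strongly_connected (with_proj G)"
    using assms(2) sym_arcs by (intro symmetric_connected_imp_strongly_connected) auto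
  then have "x \<rightarrow>\<^sup>*\<^bsub>with_proj G\<^esub> z"
    using z(1) assms(4) by (auto simp: strongly_connected_def)
  then obtain p where "awalk x p z" by (auto simp: reachable_awalk)
  with z(2) that show ?thesis by (cases p) (auto simp: awalk_def)
qed

section \<open>Packing colorings as functions\<close>

text \<open>A function makes the classes disjoint and covering by construction, so colors can be
  renumbered or merged pointwise.\<close>

definition packing_coloring :: "'a pair_pre_digraph \<Rightarrow> nat \<Rightarrow> ('a \<Rightarrow> nat) \<Rightarrow> bool" where
  "packing_coloring G k f \<longleftrightarrow> f ` pverts G \<subseteq> {1..k} \<and>
     (\<forall>u\<in>pverts G. \<forall>v\<in>pverts G. u \<noteq> v \<longrightarrow> f u = f v \<longrightarrow> ereal (real (f u)) < graph_dist G u v)"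

lemma packing_coloringD:
  assumes "packing_coloring G k f"
  shows "v \<in> pverts G \<Longrightarrow> f v \<in> {1..k}"
    and "u \<in> pverts G \<Longrightarrow> v \<in> pverts G \<Longrightarrow> u \<noteq> v \<Longrightarrow> f u = f v \<Longrightarrow>
      ereal (real (f u)) < graph_dist G u v"
  using assms by (auto simp: packing_coloring_def)

lemma packing_colorable_iff: "packing_colorable G k \<longleftrightarrow> (\<exists>f. packing_coloring G k f)"
proof
  assume "packing_colorable G k"
  then obtain V where V: "disjoint_family_on V {1..k}" "(\<Union>i\<in>{1..k}. V i) = pverts G"
    "\<forall>i\<in>{1..k}. packing G i (V i)"
    unfolding packing_colorable_def by blast
  have "\<forall>v\<in>pverts G. \<exists>i. i \<in> {1..k} \<and> v \<in> V i" using V(2) by blast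
  then obtain f where f: "\<forall>v\<in>pverts G. f v \<in> {1..k} \<and> v \<in> V (f v)" by metis
  have "ereal (real (f u)) < graph_dist G u v"
    if "u \<in> pverts G" "v \<in> pverts G" "u \<noteq> v" "f u = f v" for u v
  proof -
    have "u \<in> V (f u)" "v \<in> V (f u)" "f u \<in> {1..k}" using f that by auto
    with V(3) that(3) show ?thesis unfolding packing_def by blast
  qed
  with f show "\<exists>f. packing_coloring G k f"
    unfolding packing_coloring_def by (intro exI[of _ f]) blast
next
  assume "\<exists>f. packing_coloring G k f"
  then obtain f where f: "packing_coloring G k f" by blast
  define V where "V i = {v \<in> pverts G. f v = i}" for i
  have "disjoint_family_on V {1..k}"
    by (auto simp: disjoint_family_on_def V_def)
  moreover have "(\<Union>i\<in>{1..k}. V i) = pverts G"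
    using packing_coloringD(1)[OF f] by (auto simp: V_def)
  moreover have "\<forall>i\<in>{1..k}. packing G i (V i)"
    unfolding packing_def
  proof (intro ballI conjI impI)
    fix i u v assume "u \<in> V i" "v \<in> V i" "u \<noteq> v"
    then have "u \<in> pverts G" "v \<in> pverts G" "f u = f v" "f u = i" by (simp_all add: V_def)
    with packing_coloringD(2)[OF f] \<open>u \<noteq> v\<close> show "ereal (real i) < graph_dist G u v" by metis
  qed (auto simp: V_def)
  ultimately show "packing_colorable G k"
    unfolding packing_colorable_def by (intro exI[of _ V] conjI)
qed

lemma packing_colorable_packing_chromatic_number:
  "finite (pverts G) \<Longrightarrow> packing_colorable G (packing_chromatic_number G)"
  unfolding packing_chromatic_number_def by (rule LeastI) (rule packing_colorable_card)

lemma packing_chromatic_number_le: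
  "packing_colorable G k \<Longrightarrow> packing_chromatic_number G \<le> k"
  unfolding packing_chromatic_number_def by (rule Least_le)

text \<open>Colors above \<open>d\<close> or \<open>e\<close> move down to close the gaps. The
  classes stay the same and no color grows, so each distance requirement only weakens.\<close>

lemma packing_colorable_drop_colors:
  assumes f: "packing_coloring G k f"
    and d: "d \<in> {1..k}" "e \<in> {1..k}" "d \<noteq> e"
    and unused: "d \<notin> f ` pverts G" "e \<notin> f ` pverts G"
  shows "packing_colorable G (k - 2)"
proof -
  define g where
    "g v = f v - (if d < f v then 1 else 0) - (if e < f v then 1 else 0)" for v
  have ne: "f v \<noteq> d" "f v \<noteq> e" "1 \<le> f v" "f v \<le> k" if "v \<in> pverts G" for v
    using unused packing_coloringD(1)[OF f that] that by auto
  have "g v \<in> {1..k - 2}" if "v \<in> pverts G" for v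
    using ne[OF that] d by (auto simp: g_def)
  moreover have "ereal (real (g u)) < graph_dist G u v"
    if uv: "u \<in> pverts G" "v \<in> pverts G" "u \<noteq> v" "g u = g v" for u v
  proof -
    \<comment> \<open>The renumbering is strictly increasing on the colors other than
      \<open>d\<close> and \<open>e\<close>, so it merges no classes.\<close>
    have "f u = f v"
      using uv(4) ne[OF uv(1)] ne[OF uv(2)] d by (auto simp: g_def split: if_splits)
    then have "ereal (real (f u)) < graph_dist G u v"
      using packing_coloringD(2)[OF f] uv by blast
    moreover have "ereal (real (g u)) \<le> ereal (real (f u))" by (simp add: g_def)
    ultimately show ?thesis by (rule le_less_trans[rotated])
  qed
  ultimately show ?thesis
    unfolding packing_colorable_iff packing_coloring_def by blast
qed

section \<open>The Mycielskian\<close>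

lemma pverts_mycielskian_iff [simp]:
  "Orig x \<in> pverts (mycielskian G) \<longleftrightarrow> x \<in> pverts G"
  "Copy x \<in> pverts (mycielskian G) \<longleftrightarrow> x \<in> pverts G"
  "Apex \<in> pverts (mycielskian G)"
  by (auto simp: mycielskian_def)

lemma parcs_mycielskian_iff [simp]:
  "(Orig x, Orig y) \<in> parcs (mycielskian G) \<longleftrightarrow> (x, y) \<in> parcs G"
  "(Orig x, Copy y) \<in> parcs (mycielskian G) \<longleftrightarrow> (x, y) \<in> parcs G"
  "(Copy y, Orig x) \<in> parcs (mycielskian G) \<longleftrightarrow> (x, y) \<in> parcs G"
  "(Apex, Copy x) \<in> parcs (mycielskian G) \<longleftrightarrow> x \<in> pverts G"
  "(Copy x, Apex) \<in> parcs (mycielskian G) \<longleftrightarrow> x \<in> pverts G"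
  "(Copy x, Copy y) \<notin> parcs (mycielskian G)"
  by (auto simp: mycielskian_def)

text \<open>Applying \<open>Orig\<close> to both ends of every arc lifts a walk to one of equal
  length.\<close>

lemma graph_dist_Orig_le:
  assumes "pair_graph G"
  shows "graph_dist (mycielskian G) (Orig x) (Orig y) \<le> graph_dist G x y"
proof -
  let ?M = "mycielskian G"
  have G: "pair_wf_digraph G" and M: "pair_wf_digraph ?M"
    using assms pair_graph_mycielskian pair_wf_digraph_if_pair_graph by blast+
  have "graph_dist ?M (Orig x) (Orig y) \<le> ereal (real (length p))"
    if p: "pre_digraph.awalk (with_proj G) x p y" for p
  proof -
    let ?q = "map (map_prod Orig Orig) p"
    have "pcas (Orig x) ?q (Orig y)" if "pcas x p y"
      using that by (induction p arbitrary: x) auto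
    moreover have "set ?q \<subseteq> parcs ?M" if "set p \<subseteq> parcs G"
      using that by auto
    ultimately have "pre_digraph.awalk (with_proj ?M) (Orig x) ?q (Orig y)"
      using p by (simp add: pre_digraph.awalk_def cas_with_proj_eq)
    from graph_dist_le_length[OF M this] show ?thesis by simp
  qed
  then show ?thesis
    unfolding graph_dist_conv_length[OF G, of x y] by (intro INF_greatest) simp
qed

section \<open>Lower bound: restricting colorings to the original vertices\<close>

lemma packing_coloring_Orig:
  assumes "pair_graph G" "packing_coloring (mycielskian G) k f"
  shows "packing_coloring G k (f \<circ> Orig)"
  unfolding packing_coloring_def
proof (intro conjI ballI impI)
  show "(f \<circ> Orig) ` pverts G \<subseteq> {1..k}"
    using packing_coloringD(1)[OF assms(2), of "Orig _"] by auto
  fix u v assume "u \<in> pverts G" "v \<in> pverts G" "u \<noteq> v" "(f \<circ> Orig) u = (f \<circ> Orig) v"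
  then have "ereal (real (f (Orig u))) < graph_dist (mycielskian G) (Orig u) (Orig v)"
    using packing_coloringD(2)[OF assms(2)] by simp
  also note graph_dist_Orig_le[OF assms(1)]
  finally show "ereal (real ((f \<circ> Orig) u)) < graph_dist G u v" by simp
qed

text \<open>\<open>nbr\<close> carries what is taken from connectedness: it supplies intermediate
  vertices of short walks that end in original vertices.\<close>

lemma packing_colorable_from_mycielskian:
  assumes G: "pair_graph G"
    and nbr: "\<And>x. x \<in> pverts G \<Longrightarrow> \<exists>y. (x, y) \<in> parcs G"
    and card: "card (pverts G) \<ge> 2"
    and f: "packing_coloring (mycielskian G) k f"
  shows "packing_colorable G (k - 2)"
proof -
  let ?M = "mycielskian G"
  interpret pair_graph G by fact
  have sym: "(y, x) \<in> parcs G" if "(x, y) \<in> parcs G" for x y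
    using pair_sym_arcs that by (auto simp: symmetric_def dest: symD)
  have wfG: "pair_wf_digraph G" and M: "pair_wf_digraph ?M"
    using G pair_graph_mycielskian pair_wf_digraph_if_pair_graph by blast+
  have clash: "f u \<noteq> f v" if "u \<in> pverts ?M" "v \<in> pverts ?M" "u \<noteq> v"
    "graph_dist ?M u v \<le> ereal (real n)" "n \<le> f u" for u v n
  proof
    assume "f u = f v"
    then have "ereal (real (f u)) < graph_dist ?M u v"
      using packing_coloringD(2)[OF f] that by blast
    also note that(4)
    finally show False using that(5) by simp
  qed
  have in_range: "f u \<in> {1..k}" if "u \<in> pverts ?M" for u
    using packing_coloringD(1)[OF f that] .
  \<comment> \<open>\<open>u\<close> and \<open>v\<close> serve to name two distinct colors that no
    original vertex has.\<close>
  have drop: ?thesis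
    if "u \<in> pverts ?M" "v \<in> pverts ?M" "f u \<noteq> f v"
      "\<And>y. y \<in> pverts G \<Longrightarrow> f (Orig y) \<noteq> f u" "\<And>y. y \<in> pverts G \<Longrightarrow> f (Orig y) \<noteq> f v" for u v
    using that by (intro packing_colorable_drop_colors[OF packing_coloring_Orig[OF G f],
          of "f u" "f v"] in_range) (metis comp_apply imageE)+
  \<comment> \<open>The walk is \<open>Copy x\<close>, \<open>Apex\<close>, \<open>Copy z\<close>,
    \<open>Orig y\<close> for a neighbor \<open>z\<close> of \<open>y\<close>.\<close>
  have far: "f (Orig y) \<noteq> f (Copy x)"
    if xy: "x \<in> pverts G" "y \<in> pverts G" and "3 \<le> f (Copy x)" for x y
  proof -
    obtain z where z: "(y, z) \<in> parcs G" using nbr xy by blast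
    then have "graph_dist ?M (Copy x) (Orig y) \<le> 3"
      using xy in_arcsD2[OF z] by (intro graph_dist_le3[OF M, of _ Apex "Copy z"]) (simp_all add: sym)
    with clash[of "Copy x" "Orig y" 3] that show ?thesis by auto
  qed
  \<comment> \<open>A copy reaches its own original in two steps through a neighbor, and adjacent
    originals directly, so here color 2 is already excluded.\<close>
  have near: "f (Orig y) \<noteq> f (Copy x)"
    if xy: "x \<in> pverts G" "y \<in> pverts G" "y = x \<or> (x, y) \<in> parcs G" and "2 \<le> f (Copy x)" for x y
  proof -
    have "graph_dist ?M (Copy x) (Orig y) \<le> 2"
    proof (cases "y = x")
      case True
      obtain z where z: "(x, z) \<in> parcs G" using nbr xy by blast
      from z sym[OF z] True show ?thesis
        by (intro graph_dist_le2[OF M, of _ "Orig z"]) simp_all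
    next
      case False
      then have "(y, x) \<in> parcs G" using xy sym by blast
      then have "graph_dist ?M (Copy x) (Orig y) \<le> 1"
        by (intro graph_dist_le1[OF M]) simp
      then show ?thesis by (rule order_trans) (simp add: one_ereal_def)
    qed
    with clash[of "Copy x" "Orig y" 2] that show ?thesis by auto
  qed
  have copies: "f (Copy x) \<noteq> f (Copy y)"
    if "x \<in> pverts G" "y \<in> pverts G" "x \<noteq> y" "2 \<le> f (Copy x)" for x y
    using that clash[of "Copy x" "Copy y" 2] graph_dist_le2[OF M, of "Copy x" Apex "Copy y"] by auto
  have apex_copy: "f Apex \<noteq> f (Copy x)" if "x \<in> pverts G" for x
    using that clash[of Apex "Copy x" 1] graph_dist_le1[OF M, of Apex "Copy x"]
      in_range[of Apex] by (auto simp: one_ereal_def)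
  have apex_orig: "f (Orig x) \<noteq> f Apex" if x: "x \<in> pverts G" and "2 \<le> f Apex" for x
  proof -
    obtain z where z: "(x, z) \<in> parcs G" using nbr x by blast
    then have "graph_dist ?M Apex (Orig x) \<le> 2"
      using in_arcsD2[OF z] by (intro graph_dist_le2[OF M, of _ "Copy z"]) simp_all
    with clash[of Apex "Orig x" 2] that show ?thesis by auto
  qed
  show ?thesis
  proof (cases "f Apex = 1")
    case True
    have ge2: "2 \<le> f (Copy x)" if "x \<in> pverts G" for x
      using apex_copy[OF that] in_range[of "Copy x"] that True by auto
    obtain x y where xy: "x \<in> pverts G" "y \<in> pverts G" "x \<noteq> y"
      using card card_le_Suc0_iff_eq[OF pair_finite_verts] by (auto simp: not_less_eq_eq[symmetric])
    show ?thesis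
    proof (cases "pverts G = {x, y}")
      case True
      \<comment> \<open>With two vertices, the neighbor of one can only be the other. Hence
        \<open>near\<close> applies to every original from either copy.\<close>
      have arc: "(a, b) \<in> parcs G" if "a \<noteq> b" "a \<in> {x, y}" "b \<in> {x, y}" for a b
      proof -
        have "a \<in> pverts G" using that(2) True by simp
        then obtain c where c: "(a, c) \<in> parcs G" using nbr by blast
        moreover have "c \<noteq> a" using c no_loops by fastforce
        moreover have "c \<in> {x, y}" using in_arcsD2[OF c] True by simp
        ultimately show ?thesis using that by auto
      qed
      show ?thesis
        using xy arc True by (intro drop[of "Copy x" "Copy y"] copies near ge2) auto
    next
      case False
      then obtain z where z: "z \<in> pverts G" "z \<noteq> x" "z \<noteq> y" using xy by auto
      \<comment> \<open>Of three distinct colors that are at least 2, at most one equals 2.\<close>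
      have "\<exists>a b. a \<in> pverts G \<and> b \<in> pverts G \<and> a \<noteq> b \<and> 3 \<le> f (Copy a) \<and> 3 \<le> f (Copy b)"
      proof -
        have ge3: "3 \<le> f (Copy a)" if "a \<in> pverts G" "f (Copy a) \<noteq> 2" for a
          using ge2[OF that(1)] that(2) by simp
        have "f (Copy x) \<noteq> f (Copy y)" "f (Copy x) \<noteq> f (Copy z)" "f (Copy y) \<noteq> f (Copy z)"
          using copies ge2 xy z by metis+
        then show ?thesis using ge3 xy z by metis
      qed
      then obtain a b where "a \<in> pverts G" "b \<in> pverts G" "a \<noteq> b"
        "3 \<le> f (Copy a)" "3 \<le> f (Copy b)" by blast
      then show ?thesis
        by (intro drop[of "Copy a" "Copy b"] copies far) auto
    qed
  next
    case False
    then have apex: "2 \<le> f Apex" using in_range[of Apex] by auto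
    show ?thesis
    proof (cases "\<exists>x\<in>pverts G. 3 \<le> f (Copy x)")
      case True
      then obtain x where "x \<in> pverts G" "3 \<le> f (Copy x)" by blast
      then show ?thesis
        using apex by (intro drop[of Apex "Copy x"] apex_copy apex_orig far) auto
    next
      case False
      then have copy12: "f (Copy x) \<in> {1, 2}" if "x \<in> pverts G" for x
        using in_range[of "Copy x"] that by (force simp: not_le)
      have orig1: "f (Copy y) = 2" if "(x, y) \<in> parcs G" "f (Orig x) = 1" for x y
      proof -
        have "f (Orig x) \<noteq> f (Copy y)"
          using that clash[of "Orig x" "Copy y" 1] graph_dist_le1[OF M, of "Orig x" "Copy y"]
          by (auto simp: one_ereal_def dest: in_arcsD1 in_arcsD2)
        then show ?thesis using copy12[of y] that by (auto dest: in_arcsD2)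
      qed
      show ?thesis
      proof (cases "f Apex = 2")
        case True
        obtain x where x: "x \<in> pverts G" using card by fastforce
        \<comment> \<open>The copies are adjacent to \<open>Apex\<close>, which leaves them color 1.
          Each original is adjacent to some copy, so color 1 is absent from the originals, as is
          color 2 of \<open>Apex\<close>.\<close>
        have copy1: "f (Copy y) = 1" if "y \<in> pverts G" for y
          using copy12[OF that] apex_copy[OF that] True by auto
        have "f (Orig y) \<noteq> 1" if y: "y \<in> pverts G" for y
        proof
          assume 1: "f (Orig y) = 1"
          obtain z where z: "(y, z) \<in> parcs G" using nbr y by blast
          show False using orig1[OF z 1] copy1[OF in_arcsD2[OF z]] by simp
        qed
        then show ?thesis
          using x apex apex_copy apex_orig copy1[OF x] by (intro drop[of Apex "Copy x"]) auto
      next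
        case apex_ne_2: False
        \<comment> \<open>Color 2 is merged into color 1. This frees color 2, besides the color of
          \<open>Apex\<close>, which is at least 3 here. The merged class needs only nonadjacency,
          and \<open>no12\<close> gives it for pairs whose old colors differ.\<close>
        define g where "g x = (if f (Orig x) = 2 then 1 else f (Orig x))" for x
        text \<open>If \<open>x\<close> of color 1 and \<open>y\<close> of color 2 were adjacent, the copy of \<open>y\<close> would have
          color 2 at distance 2 from \<open>y\<close>.\<close>
        have no12: "(x, y) \<notin> parcs G" if "f (Orig x) = 1" "f (Orig y) = 2" for x y
        proof
          assume xy: "(x, y) \<in> parcs G"
          show False
            using near[of y y] orig1[OF xy that(1)] in_arcsD2[OF xy] that(2) by simp
        qed
        have "packing_coloring G k g"
          unfolding packing_coloring_def
        proof (intro conjI ballI impI)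
          show "g ` pverts G \<subseteq> {1..k}"
            using packing_coloringD(1)[OF packing_coloring_Orig[OF G f]] by (fastforce simp: g_def)
          fix u v assume uv: "u \<in> pverts G" "v \<in> pverts G" "u \<noteq> v" "g u = g v"
          note orig = packing_coloringD(2)[OF packing_coloring_Orig[OF G f] uv(1-3)]
          show "ereal (real (g u)) < graph_dist G u v"
          proof (cases "f (Orig u) = f (Orig v)")
            case True
            have "ereal (real (g u)) \<le> ereal (real (f (Orig u)))" by (simp add: g_def)
            also have "\<dots> < graph_dist G u v" using orig True by simp
            finally show ?thesis .
          next
            case False
            with uv(4) have "f (Orig u) = 1 \<and> f (Orig v) = 2 \<or> f (Orig u) = 2 \<and> f (Orig v) = 1"
              by (auto simp: g_def split: if_splits)
            then have "(u, v) \<notin> parcs G" "g u = 1"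
              using no12 sym by (auto simp: g_def)
            then show ?thesis
              using graph_dist_gt1[OF wfG uv(3)] by (simp add: one_ereal_def)
          qed
        qed
        moreover have "f Apex \<notin> g ` pverts G"
        proof
          assume "f Apex \<in> g ` pverts G"
          then obtain x where "x \<in> pverts G" "f Apex = g x" by blast
          with apex_orig[of x] apex show False by (auto simp: g_def split: if_splits)
        qed
        moreover have "2 \<notin> g ` pverts G" by (auto simp: g_def)
        moreover have "2 \<in> {1..k}" "f Apex \<in> {1..k}" using in_range[of Apex] apex by auto
        ultimately show ?thesis
          using apex_ne_2 by (intro packing_colorable_drop_colors[of G k g "f Apex" 2]) auto
      qed
    qed
  qed
qed

text \<open>Every color is at least 1, so the ends of an arc cannot share one. This guards against
  truncation in \<open>k - 2\<close>.\<close>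

lemma packing_colorable_ge2:
  assumes "pair_wf_digraph G" "(x, y) \<in> parcs G" "x \<noteq> y" "packing_colorable G k"
  shows "2 \<le> k"
proof -
  interpret pair_wf_digraph G by fact
  obtain f where f: "packing_coloring G k f"
    using assms(4) unfolding packing_colorable_iff by blast
  have xy: "x \<in> pverts G" "y \<in> pverts G" using assms(2) in_arcsD1 in_arcsD2 by blast+
  have "f x \<noteq> f y"
  proof
    assume "f x = f y"
    then have "ereal (real (f x)) < graph_dist G x y"
      using packing_coloringD(2)[OF f xy assms(3)] by simp
    also note graph_dist_le1[OF assms(1,2)]
    finally show False using packing_coloringD(1)[OF f xy(1)] by (simp add: one_ereal_def)
  qed
  then show ?thesis
    using packing_coloringD(1)[OF f xy(1)] packing_coloringD(1)[OF f xy(2)] by auto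
qed

section \<open>Equality for complete graphs\<close>

lemma packing_chromatic_number_complete_ge:
  assumes "pair_graph G"
    and complete: "\<And>u v. u \<in> pverts G \<Longrightarrow> v \<in> pverts G \<Longrightarrow> u \<noteq> v \<Longrightarrow> (u, v) \<in> parcs G"
  shows "card (pverts G) \<le> packing_chromatic_number G"
proof -
  interpret pair_graph G by fact
  obtain f where f: "packing_coloring G (packing_chromatic_number G) f"
    using packing_colorable_packing_chromatic_number[OF pair_finite_verts]
    unfolding packing_colorable_iff by blast
  \<comment> \<open>All distances are at most 1 and all colors at least 1, so no color can
    repeat.\<close>
  have "inj_on f (pverts G)"
  proof (rule inj_onI, rule ccontr)
    fix u v assume uv: "u \<in> pverts G" "v \<in> pverts G" "f u = f v" "u \<noteq> v"
    have "ereal (real (f u)) < graph_dist G u v" using packing_coloringD(2)[OF f] uv by blast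
    also have "\<dots> \<le> 1"
      using uv complete by (intro graph_dist_le1 pair_wf_digraph_if_pair_graph assms(1)) auto
    finally show False
      using packing_coloringD(1)[OF f uv(1)] by (simp add: one_ereal_def)
  qed
  moreover have "f ` pverts G \<subseteq> {1..packing_chromatic_number G}"
    using f by (simp add: packing_coloring_def)
  ultimately have "card (pverts G) \<le> card {1..packing_chromatic_number G}"
    by (rule card_inj_on_le) simp
  then show ?thesis by simp
qed

text \<open>The copies are pairwise nonadjacent and share color 1. The originals take distinct
  colors from 2 to \<open>?n + 1\<close>, and \<open>Apex\<close> takes
  \<open>?n + 2\<close>.\<close>

lemma packing_chromatic_number_mycielskian_le:
  assumes "pair_graph G"
  shows "packing_chromatic_number (mycielskian G) \<le> card (pverts G) + 2"
proof -
  interpret pair_graph G by fact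
  let ?M = "mycielskian G" and ?n = "card (pverts G)"
  have M: "pair_wf_digraph ?M"
    using assms pair_graph_mycielskian pair_wf_digraph_if_pair_graph by blast
  obtain h where h: "bij_betw h (pverts G) {1..?n}"
    using ex_bij_betw_nat_finite_1[OF pair_finite_verts] bij_betw_inv by blast
  have hD: "1 \<le> h x" "h x \<le> ?n" if "x \<in> pverts G" for x
    using bij_betwE[OF h] that by auto
  define f where "f = case_myc_vertex (\<lambda>x. h x + 1) (\<lambda>_. 1) (?n + 2)"
  have "packing_coloring ?M (?n + 2) f"
    unfolding packing_coloring_def
  proof (intro conjI ballI impI)
    show "f ` pverts ?M \<subseteq> {1..?n + 2}"
      using hD(2) by (fastforce simp: mycielskian_def f_def intro: le_SucI)
    fix u v assume uv: "u \<in> pverts ?M" "v \<in> pverts ?M" "u \<noteq> v" "f u = f v"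
    then obtain x y where "u = Copy x" "v = Copy y"
      using hD bij_betw_imp_inj_on[OF h]
      by (cases u; cases v) (fastforce simp: f_def dest: inj_onD)+
    then show "ereal (real (f u)) < graph_dist ?M u v"
      using graph_dist_gt1[OF M uv(3)] by (simp add: f_def one_ereal_def)
  qed
  then show ?thesis
    by (intro packing_chromatic_number_le) (auto simp: packing_colorable_iff)
qed

theorem theorem2p4:
  fixes G :: "'a pair_pre_digraph"
  assumes "pair_graph G"
    and "connected (with_proj G)"
    and "card (pverts G) \<ge> 2"
  shows "packing_chromatic_number (mycielskian G) \<ge> packing_chromatic_number G + 2 \<and>
    (complete_digraph (card (pverts G)) (with_proj G) \<longrightarrow>
       packing_chromatic_number (mycielskian G) = packing_chromatic_number G + 2)"
proof -
  let ?M = "mycielskian G"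
  interpret pair_graph G by fact
  interpret M: pair_graph ?M using assms(1) by (rule pair_graph_mycielskian)
  let ?k = "packing_chromatic_number ?M"
  have nbr: "\<exists>y. (x, y) \<in> parcs G" if "x \<in> pverts G" for x
    using connected_obtain_neighbor[OF assms that] by blast
  have col: "packing_colorable ?M ?k"
    by (rule packing_colorable_packing_chromatic_number[OF M.pair_finite_verts])
  then obtain f where "packing_coloring ?M ?k f" unfolding packing_colorable_iff by blast
  then have "packing_chromatic_number G \<le> ?k - 2"
    using packing_colorable_from_mycielskian[OF assms(1) nbr assms(3)]
    by (intro packing_chromatic_number_le) blast
  \<comment> \<open>Subtraction on naturals truncates, so \<open>?k - 2\<close> yields the bound
    with \<open>+ 2\<close> only once \<open>?k\<close> is at least 2. An arc from
    \<open>Apex\<close> to a copy ensures this.\<close>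
  moreover have "2 \<le> ?k"
  proof -
    obtain x where "x \<in> pverts G" using assms(3) by fastforce
    then show ?thesis
      using col M.pair_wf_digraph_axioms by (intro packing_colorable_ge2[of ?M Apex "Copy x"]) auto
  qed
  ultimately have "packing_chromatic_number G + 2 \<le> ?k" by simp
  moreover have "?k \<le> packing_chromatic_number G + 2"
    if "complete_digraph (card (pverts G)) (with_proj G)"
  proof -
    have "card (pverts G) \<le> packing_chromatic_number G"
      using that by (intro packing_chromatic_number_complete_ge assms(1))
        (auto simp: complete_digraph_pair_def)
    with packing_chromatic_number_mycielskian_le[OF assms(1)] show ?thesis by simp
  qed
  ultimately show ?thesis by (auto intro: antisym)
qed

end
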